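(* Let $r\ge 5$ and let $M$ be a simple ternary matroid (i.e. representable over $GF(3)$) of rank $r$ that contains a loose element and has no coloops. If $r>10$, then $|E(M)|\le \left\lfloor \frac{41r-101}{2}\right\rfloor$. If $r\le 10$, then $|E(M)|\le \left\lfloor \frac{35r-35}{2}\right\rfloor$.
   Context: All matroids are finite. An element $t$ of a matroid $M$ is loose if every circuit of $M$ containing $t$ has size at least the rank $r(M)$. *)

theory Defs
  imports Main "HOL-Library.Disjoint_Sets" Complex_Main
begin

definition matroid :: "'a set \<Rightarrow> ('a set \<Rightarrow> bool) \<Rightarrow> bool" where
  "matroid E indep \<longleftrightarrow>
     finite E \<and>
     (\<forall>X. indep X \<longrightarrow> X \<subseteq> E) \<and>
     indep {} \<and>
     (\<forall>X Y. indep X \<and> Y \<subseteq> X \<longrightarrow> indep Y) \<and>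
     (\<forall>X Y. indep X \<and> indep Y \<and> card X < card Y \<longrightarrow>
        (\<exists>y \<in> Y - X. indep (insert y X)))"

definition mrank :: "'a set \<Rightarrow> ('a set \<Rightarrow> bool) \<Rightarrow> nat" where
  "mrank E indep = Max {card X | X. X \<subseteq> E \<and> indep X}"

definition basis :: "'a set \<Rightarrow> ('a set \<Rightarrow> bool) \<Rightarrow> 'a set \<Rightarrow> bool" where
  "basis E indep B \<longleftrightarrow> B \<subseteq> E \<and> indep B \<and>
     (\<forall>X. X \<subseteq> E \<and> indep X \<and> B \<subseteq> X \<longrightarrow> X = B)"

definition circuit :: "'a set \<Rightarrow> ('a set \<Rightarrow> bool) \<Rightarrow> 'a set \<Rightarrow> bool" where
  "circuit E indep C \<longleftrightarrow> C \<subseteq> E \<and> \<not> indep C \<and> (\<forall>x \<in> C. indep (C - {x}))"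

definition simple_matroid :: "'a set \<Rightarrow> ('a set \<Rightarrow> bool) \<Rightarrow> bool" where
  "simple_matroid E indep \<longleftrightarrow> (\<forall>C. circuit E indep C \<longrightarrow> card C \<ge> 3)"

definition coloop :: "'a set \<Rightarrow> ('a set \<Rightarrow> bool) \<Rightarrow> 'a \<Rightarrow> bool" where
  "coloop E indep e \<longleftrightarrow> e \<in> E \<and> (\<forall>B. basis E indep B \<longrightarrow> e \<in> B)"

definition loose :: "'a set \<Rightarrow> ('a set \<Rightarrow> bool) \<Rightarrow> 'a \<Rightarrow> bool" where
  "loose E indep t \<longleftrightarrow> t \<in> E \<and>
     (\<forall>C. circuit E indep C \<and> t \<in> C \<longrightarrow> card C \<ge> mrank E indep)"

text \<open>Linear independence over GF(3) of the family (v x)_{x \<in> X} of vectors in GF(3)^\<nat>;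
  integer entries are read modulo 3.\<close>
definition gf3_indep :: "('a \<Rightarrow> nat \<Rightarrow> int) \<Rightarrow> 'a set \<Rightarrow> bool" where
  "gf3_indep v X \<longleftrightarrow>
     (\<forall>c :: 'a \<Rightarrow> int. (\<forall>i. (\<Sum>x\<in>X. c x * v x i) mod 3 = 0) \<longrightarrow> (\<forall>x\<in>X. c x mod 3 = 0))"

definition ternary :: "'a set \<Rightarrow> ('a set \<Rightarrow> bool) \<Rightarrow> bool" where
  "ternary E indep \<longleftrightarrow>
     (\<exists>v :: 'a \<Rightarrow> nat \<Rightarrow> int. \<forall>X. X \<subseteq> E \<longrightarrow> (indep X \<longleftrightarrow> gf3_indep v X))"

end

theory Submission
  imports Defs "HOL-Library.Numeral_Type"
begin

text \<open>
  Let \<open>T\<close> be a smallest subset of \<open>E - {t}\<close> whose span contains the loose element \<open>t\<close>. Then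
  \<open>T \<union> {t}\<close> is a circuit, so \<open>|T| \<ge> r - 1\<close>, and \<open>T\<close> extends to a basis \<open>B\<close> avoiding \<open>t\<close>. In
  coordinates with respect to \<open>B\<close>, scaled so that \<open>t\<close> is the indicator vector of \<open>T\<close>, minimality
  of \<open>T\<close> says that a combination of \<open>k\<close> elements outside \<open>T\<close> that vanishes on \<open>B - T\<close> has at
  most \<open>k\<close> entries 1 on \<open>T\<close>.

  The elements outside \<open>T\<close> that vanish on \<open>B - T\<close> are therefore of the form \<open>e\<^sub>i - e\<^sub>j\<close> with
  pairwise disjoint supports, and there are at most \<open>|T|\<close> of them. If \<open>B - T = {q}\<close>, the
  remaining elements, scaled to have entry 1 at \<open>q\<close>, restrict to a family \<open>F\<close> of vectors in
  \<open>GF(3)\<^sup>T\<close> in which differences of two members have at most two entries 1, and sums of three members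
  have at most three entries 1 and at most three entries -1.

  Deleting a coordinate preserves these two conditions and loses at most two members of \<open>F\<close> for
  each fibre with more than one point. The images of such fibres satisfy the conditions with the
  bounds lowered by one, which leaves room for at most seven of them. Hence
  \<open>|F| \<le> 14 |T| + 1\<close>, and \<open>|E| \<le> 16 (r - 1) + 2\<close> unless \<open>B = T\<close>, where \<open>|E| \<le> 2 r + 1\<close>.
\<close>

section \<open>Ternary vectors with few equal entries\<close>

lemma UNIV_gf3: "(UNIV :: 3 set) = {0, 1, -1}"
  by (rule sym, rule card_subset_eq) auto

lemma gf3_cases: "x = 0 \<or> x = 1 \<or> x = -1" for x :: 3
  using UNIV_I[of x] unfolding UNIV_gf3 by auto

text \<open>Every nonzero element is its own inverse, so division below is multiplication by the
  same element.\<close>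

lemma gf3_square: "x \<noteq> 0 \<Longrightarrow> x * x = 1" for x :: 3
  using gf3_cases[of x] by auto

lemma gf3_three_times [simp]: "3 * x = 0" "x * 3 = 0" for x :: 3
  using gf3_cases[of x] by auto

lemma of_int_gf3_eq_0_iff: "of_int k = (0::3) \<longleftrightarrow> k mod 3 = 0"
proof -
  have "(of_int (3 * q + m) :: 3) = of_int m" for q m by simp
  from this[of "k div 3" "k mod 3"] have *: "(of_int k :: 3) = of_int (k mod 3)"
    by (simp only: mult_div_mod_eq)
  have "k mod 3 = 0 \<or> k mod 3 = 1 \<or> k mod 3 = 2" by presburger
  then show ?thesis unfolding * by auto
qed

text \<open>The Cauchy-Davenport bound for two pairs: 2 + 2 - 1 = 3 values, which is all of
  \<open>GF(3)\<close>.\<close>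

lemma gf3_diff_cover:
  "a \<noteq> b \<Longrightarrow> c \<noteq> d \<Longrightarrow> \<exists>x\<in>{a,b}. \<exists>y\<in>{c,d}. x - y = e" for e :: 3
  using gf3_cases[of a] gf3_cases[of b] gf3_cases[of c] gf3_cases[of d] gf3_cases[of e] by auto

lemma gf3_sum_cover:
  fixes a b c d z e :: 3
  assumes "a \<noteq> b" "c \<noteq> d"
  shows "\<exists>x\<in>{a,b}. \<exists>y\<in>{c,d}. x + y + z = e"
proof -
  have "-c \<noteq> -d" using assms by simp
  then obtain x y where "x \<in> {a,b}" "y \<in> {-c,-d}" "x - y = e - z"
    using gf3_diff_cover[OF assms(1), of "-c" "-d" "e - z"] by blast
  then show ?thesis by (intro bexI[of _ x] bexI[of _ "-y"]) (auto simp: algebra_simps)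
qed

lemma three_distinct:
  assumes "3 \<le> card S"
  obtains x y z where "x \<in> S" "y \<in> S" "z \<in> S" "x \<noteq> y" "x \<noteq> z" "y \<noteq> z"
proof -
  obtain S' where "S' \<subseteq> S" "card S' = 3"
    using obtain_subset_with_card_n[OF assms] by blast
  then show thesis using that by (auto simp: card_3_iff)
qed

text \<open>The three alternatives say that two nonzero vectors with at most one entry 1 and at most one
  entry -1 behave like arcs with a common head, a common tail, or reversed orientation.\<close>
lemma sign_patterns:
  fixes P N P' N' :: "'i set"
  assumes "P \<inter> N = {}" "P' \<inter> N' = {}"
    and "\<And>i j. i \<in> P \<Longrightarrow> j \<in> P \<Longrightarrow> i = j" "\<And>i j. i \<in> N \<Longrightarrow> j \<in> N \<Longrightarrow> i = j"
    and "\<And>i j. i \<in> P' \<Longrightarrow> j \<in> P' \<Longrightarrow> i = j" "\<And>i j. i \<in> N' \<Longrightarrow> j \<in> N' \<Longrightarrow> i = j"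
    and "P \<union> N \<noteq> {}" "P' \<union> N' \<noteq> {}"
    and "\<And>i j. i \<in> (P - P' - N') \<union> (N' - P - N) \<union> (N \<inter> P') \<Longrightarrow>
               j \<in> (P - P' - N') \<union> (N' - P - N) \<union> (N \<inter> P') \<Longrightarrow> i = j"
    and "\<And>i j. i \<in> (P' - P - N) \<union> (N - P' - N') \<union> (N' \<inter> P) \<Longrightarrow>
               j \<in> (P' - P - N) \<union> (N - P' - N') \<union> (N' \<inter> P) \<Longrightarrow> i = j"
  shows "P = P' \<or> N = N' \<or> P = N' \<and> N = P'"
proof -
  have 1: "\<And>i. \<not> (i \<in> P \<and> i \<in> N)" "\<And>i. \<not> (i \<in> P' \<and> i \<in> N')"
    and 2: "\<exists>i. i \<in> P \<or> i \<in> N" "\<exists>i. i \<in> P' \<or> i \<in> N'"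
    using assms(1,2,7,8) by blast+
  show ?thesis
    unfolding set_eq_iff using 1 2 assms(3-6) assms(9,10)[unfolded Un_iff Diff_iff Int_iff]
    by (smt (verit))
qed

section \<open>Size bounds for families of ternary vectors\<close>

text \<open>Up to sign, \<open>x - y\<close> and \<open>x + y + z\<close> are the only combinations
  of two or three members, with all coefficients nonzero, that cancel a coordinate where every
  member has entry 1. Swapping \<open>x\<close> and \<open>y\<close> covers the entry -1 of
  differences; the symmetric triple sum needs both signs.\<close>

definition spread_le :: "'i set \<Rightarrow> nat \<Rightarrow> nat \<Rightarrow> ('i \<Rightarrow> 3) set \<Rightarrow> bool" where
  "spread_le I a b F \<longleftrightarrow>
     (\<forall>x\<in>F. \<forall>y\<in>F. x \<noteq> y \<longrightarrow> card {i\<in>I. x i - y i = 1} \<le> a) \<and>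
     (\<forall>x\<in>F. \<forall>y\<in>F. \<forall>z\<in>F. x \<noteq> y \<and> x \<noteq> z \<and> y \<noteq> z \<longrightarrow>
        (\<forall>e\<in>{1,-1}. card {i\<in>I. x i + y i + z i = e} \<le> b))"

text \<open>Relative to a member \<open>x0\<close>, every other member is an arc with at most one
  head and one tail. Compared with a fixed \<open>x1\<close>, at most two further members share its
  head, two its tail, and one is its reverse: 2 + 2 + 2 + 1 = 7.\<close>

lemma spread_le_1_2_card_le:
  assumes "finite I" and sp: "spread_le I 1 2 F"
    and supp: "\<And>x i. x \<in> F \<Longrightarrow> i \<notin> I \<Longrightarrow> x i = 0"
  shows "card F \<le> 7"
proof (cases "finite F \<and> (\<exists>x y. x \<in> F \<and> y \<in> F \<and> x \<noteq> y)")
  case False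
  then have "card F \<le> 1"
    by (metis card.infinite card_le_Suc0_iff_eq One_nat_def zero_le)
  then show ?thesis by simp
next
  case True
  then obtain x0 x1 where fF: "finite F" and x01: "x0 \<in> F" "x1 \<in> F" "x0 \<noteq> x1" by blast
  define L where "L e x = {i\<in>I. x i - x0 i = e}" for e and x :: "'a \<Rightarrow> 3"
  have diff1: "card {i\<in>I. x i - y i = e} \<le> 1" if "x \<in> F" "y \<in> F" "x \<noteq> y" "e \<in> {1,-1}" for x y e
  proof -
    have "{i\<in>I. x i - y i = -1} = {i\<in>I. y i - x i = 1}"
      by (metis minus_diff_eq minus_equation_iff)
    then show ?thesis using sp that unfolding spread_le_def by auto
  qed
  have diff_eq: "i = j" if "x \<in> F" "y \<in> F" "x \<noteq> y" "i \<in> I" "j \<in> I"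
      "x i - y i = e" "x j - y j = e" "e \<in> {1,-1}" for x y i j e
  proof -
    have "finite {i\<in>I. x i - y i = e}" using \<open>finite I\<close> by simp
    with diff1[OF that(1-3) that(8)] that(4-7) show ?thesis by (auto simp: card_le_Suc0_iff_eq)
  qed
  have ext: "x = y" if "x \<in> F" "y \<in> F" "L 1 x = L 1 y" "L (-1) x = L (-1) y" for x y
  proof
    fix i
    show "x i = y i"
    proof (cases "i \<in> I")
      case True
      have "x i - x0 i = y i - x0 i"
        using gf3_cases[of "x i - x0 i"] gf3_cases[of "y i - x0 i"] that(3,4) True
        unfolding L_def set_eq_iff by (metis (mono_tags, lifting) mem_Collect_eq)
      then show ?thesis by simp
    next
      case False
      then show ?thesis using supp[OF that(1)] supp[OF that(2)] by simp
    qed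
  qed
  have ext': "x = y" if "x \<in> F" "y \<in> F" "L e x = L e y" "L (-e) x = L (-e) y" "e \<in> {1,-1}" for x y e
    using ext that by auto
  \<comment> \<open>Three members with the same \<open>L e\<close> and distinct single positions
    \<open>a\<close>, \<open>b\<close>, \<open>c\<close> in \<open>L (-e)\<close> would give
    \<open>x + y + z\<close> the entry \<open>-e\<close> at all three positions, since the three
    copies of \<open>x0\<close> cancel modulo 3.\<close>
  have two: "card {x\<in>F-{x0}. L e x = Q \<and> L (-e) x \<noteq> {}} \<le> 2" if e: "e \<in> {1,-1}" for e Q
  proof (rule ccontr)
    let ?S = "{x\<in>F-{x0}. L e x = Q \<and> L (-e) x \<noteq> {}}"
    assume "\<not> ?thesis"
    then have "3 \<le> card ?S" by linarith
    then obtain x y z where "x \<in> ?S" "y \<in> ?S" "z \<in> ?S" and ne: "x \<noteq> y" "x \<noteq> z" "y \<noteq> z"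
      by (rule three_distinct)
    then have mem: "x \<in> F - {x0}" "y \<in> F - {x0}" "z \<in> F - {x0}"
      and Le: "L e x = Q" "L e y = Q" "L e z = Q"
      and Lm: "L (-e) x \<noteq> {}" "L (-e) y \<noteq> {}" "L (-e) z \<noteq> {}"
      by simp_all
    have me: "- e \<in> {1,-1}" "e \<noteq> -e" using e by auto
    have single: "\<exists>a. L (-e) x = {a}" if "x \<in> F - {x0}" "L (-e) x \<noteq> {}" for x
      using diff_eq[of x x0 _ _ "-e"] that x01(1) me unfolding L_def by blast
    obtain a b c where abc: "L (-e) x = {a}" "L (-e) y = {b}" "L (-e) z = {c}"
      using single mem Lm by metis
    have dist: "a \<noteq> b" "a \<noteq> c" "b \<noteq> c"
      using ext'[of x y e] ext'[of x z e] ext'[of y z e] mem ne Le abc e by auto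
    have zero: "u k = x0 k" if "k \<in> I" "k \<notin> L e u" "k \<notin> L (-e) u" for u k
      using gf3_cases[of "u k - x0 k"] that e unfolding L_def by auto
    have sum: "u k + v k + w k = -e" if "L (-e) u = {k}" "k \<notin> L (-e) v" "k \<notin> L (-e) w"
      "L e u = L e v" "L e w = L e v" for u v w k
    proof -
      have k: "k \<in> I" "u k = x0 k - e" using that(1) unfolding L_def by (auto simp: algebra_simps)
      have "k \<notin> L e u" using k me(2) unfolding L_def by auto
      then have "v k = x0 k" "w k = x0 k" using zero[OF k(1)] that by metis+
      then have "u k + v k + w k = (x0 k + x0 k + x0 k) - e" using k by simp
      then show ?thesis by simp
    qed
    have "{a,b,c} \<subseteq> {i\<in>I. x i + y i + z i = -e}"
    proof -
      have "{a,b,c} \<subseteq> I" using abc unfolding L_def by blast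
      moreover have "x a + y a + z a = -e" using sum[of x a y z] abc dist Le by auto
      moreover have "x b + y b + z b = -e" using sum[of y b x z] abc dist Le by (auto simp: ac_simps)
      moreover have "x c + y c + z c = -e" using sum[of z c x y] abc dist Le by (auto simp: ac_simps)
      ultimately show ?thesis by auto
    qed
    then have "card {a,b,c} \<le> card {i\<in>I. x i + y i + z i = -e}"
      using \<open>finite I\<close> by (intro card_mono) auto
    moreover have "card {i\<in>I. x i + y i + z i = -e} \<le> 2"
      using sp mem ne me(1) unfolding spread_le_def by blast
    ultimately show False using dist by simp
  qed
  \<comment> \<open>Besides the two members just counted, only one can have \<open>L (-e)\<close>
    empty, by \<open>ext'\<close>.\<close>
  have three: "card {x\<in>F-{x0}. L e x = Q} \<le> 3" if e: "e \<in> {1,-1}" for e Q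
  proof -
    define R where "R = {x\<in>F-{x0}. L e x = Q \<and> L (-e) x \<noteq> {}}"
    define R' where "R' = {x\<in>F-{x0}. L e x = Q \<and> L (-e) x = {}}"
    have "card {x\<in>F-{x0}. L e x = Q} = card (R \<union> R')"
      unfolding R_def R'_def by (rule arg_cong[where f = card]) auto
    also have "\<dots> \<le> card R + card R'" by (rule card_Un_le)
    also have "card R \<le> 2" unfolding R_def by (rule two[OF e])
    also have "card R' \<le> 1"
      using fF ext'[OF _ _ _ _ e] unfolding R'_def by (auto simp: card_le_Suc0_iff_eq)
    finally show ?thesis by simp
  qed
  have nz: "L 1 x \<union> L (-1) x \<noteq> {}" if "x \<in> F" "x \<noteq> x0" for x
  proof -
    have "L 1 x0 = {}" "L (-1) x0 = {}" unfolding L_def by auto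
    then show ?thesis using ext[of x x0] that x01 by auto
  qed
  have cmp: "L 1 x1 = L 1 x \<or> L (-1) x1 = L (-1) x \<or> L 1 x1 = L (-1) x \<and> L (-1) x1 = L 1 x"
    if x: "x \<in> F" "x \<noteq> x0" "x \<noteq> x1" for x
  proof (rule sign_patterns)
    show "L 1 x1 \<inter> L (-1) x1 = {}" "L 1 x \<inter> L (-1) x = {}" unfolding L_def by auto
    show "L 1 x1 \<union> L (-1) x1 \<noteq> {}" "L 1 x \<union> L (-1) x \<noteq> {}" using nz x x01 by auto
    show "i = j" if "i \<in> L 1 x1" "j \<in> L 1 x1" for i j
      using diff_eq[of x1 x0 i j 1] that x01 unfolding L_def by auto
    show "i = j" if "i \<in> L (-1) x1" "j \<in> L (-1) x1" for i j
      using diff_eq[of x1 x0 i j "-1"] that x01 unfolding L_def by auto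
    show "i = j" if "i \<in> L 1 x" "j \<in> L 1 x" for i j
      using diff_eq[of x x0 i j 1] that x x01 unfolding L_def by auto
    show "i = j" if "i \<in> L (-1) x" "j \<in> L (-1) x" for i j
      using diff_eq[of x x0 i j "-1"] that x x01 unfolding L_def by auto
    \<comment> \<open>The three pieces are the ways to obtain 1 as a difference: 1 - 0, 0 - (-1) and
      -1 - 1.\<close>
    have D: "u i - v i = 1 \<and> i \<in> I" if "i \<in> (L 1 u - L 1 v - L (-1) v) \<union> (L (-1) v - L 1 u - L (-1) u) \<union>
        (L (-1) u \<inter> L 1 v)" for u v i
    proof -
      have i: "i \<in> I" using that unfolding L_def by auto
      have one: "a - b = 1" if "a = 1 \<and> b = 0 \<or> a = 0 \<and> b = -1 \<or> a = -1 \<and> b = 1" for a b :: 3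
        using that by auto
      have "(u i - x0 i) - (v i - x0 i) = 1"
        by (rule one) (use that i gf3_cases[of "u i - x0 i"] gf3_cases[of "v i - x0 i"] in
            \<open>auto simp: L_def\<close>)
      then show ?thesis using i by simp
    qed
    show "i = j" if "i \<in> (L 1 x1 - L 1 x - L (-1) x) \<union> (L (-1) x - L 1 x1 - L (-1) x1) \<union>
        (L (-1) x1 \<inter> L 1 x)" "j \<in> (L 1 x1 - L 1 x - L (-1) x) \<union> (L (-1) x - L 1 x1 - L (-1) x1) \<union>
        (L (-1) x1 \<inter> L 1 x)" for i j
      using diff_eq[of x1 x i j 1] D[OF that(1)] D[OF that(2)] x x01 by auto
    show "i = j" if "i \<in> (L 1 x - L 1 x1 - L (-1) x1) \<union> (L (-1) x1 - L 1 x - L (-1) x) \<union>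
        (L (-1) x \<inter> L 1 x1)" "j \<in> (L 1 x - L 1 x1 - L (-1) x1) \<union> (L (-1) x1 - L 1 x - L (-1) x) \<union>
        (L (-1) x \<inter> L 1 x1)" for i j
      using diff_eq[of x x1 i j 1] D[OF that(1)] D[OF that(2)] x x01 by auto
  qed
  \<comment> \<open>\<open>x1\<close> belongs to its own class, so removing it lowers the bound 3 to
    2.\<close>
  define S1 where "S1 = {x\<in>F-{x0}. L 1 x = L 1 x1} - {x1}"
  define S2 where "S2 = {x\<in>F-{x0}. L (-1) x = L (-1) x1} - {x1}"
  define S3 where "S3 = {x\<in>F-{x0}. L 1 x = L (-1) x1 \<and> L (-1) x = L 1 x1}"
  have "card S1 \<le> 2" "card S2 \<le> 2"
    using three[of 1 "L 1 x1"] three[of "-1" "L (-1) x1"] x01 fF unfolding S1_def S2_def by auto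
  moreover have "card S3 \<le> 1" using fF ext unfolding S3_def by (simp add: card_le_Suc0_iff_eq)
  moreover have "F \<subseteq> {x0,x1} \<union> S1 \<union> S2 \<union> S3"
    using cmp unfolding S1_def S2_def S3_def by auto
  moreover have "finite ({x0,x1} \<union> S1 \<union> S2 \<union> S3)" using fF unfolding S1_def S2_def S3_def by auto
  moreover have "card ({x0,x1} \<union> S1 \<union> S2 \<union> S3) \<le> card {x0,x1} + card S1 + card S2 + card S3"
    using card_Un_le[of "{x0,x1} \<union> S1 \<union> S2" S3] card_Un_le[of "{x0,x1} \<union> S1" S2]
      card_Un_le[of "{x0,x1}" S1] by linarith
  moreover have "card {x0,x1} \<le> 2" by (simp add: card_insert_if)
  ultimately show ?thesis
    using card_mono[of "{x0,x1} \<union> S1 \<union> S2 \<union> S3" F] by linarith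
qed

text \<open>Each coordinate costs 14 = 2 * 7: at most seven fibres have several points, and each
  loses at most two. The \<open>+ 1\<close> is the zero vector that remains over the empty index
  set.\<close>

lemma spread_le_2_3_card_le:
  assumes "finite I" "finite F" "spread_le I 2 3 F"
    and "\<And>x i. x \<in> F \<Longrightarrow> i \<notin> I \<Longrightarrow> x i = 0"
  shows "card F \<le> 14 * card I + 1"
  using assms
proof (induction I arbitrary: F rule: finite_induct)
  case empty
  then have "F \<subseteq> {\<lambda>_. 0}" by auto
  then have "card F \<le> card {\<lambda>_::'a. 0::3}" by (intro card_mono) auto
  then show ?case by simp
next
  case (insert k I F)
  \<comment> \<open>Overwriting by 0 instead of restricting keeps the type and the support condition
    for the induction hypothesis.\<close>
  define \<pi> where "\<pi> x = x(k := 0::3)" for x :: "'a \<Rightarrow> 3"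
  define G where "G = \<pi> ` F"
  define fib where "fib g = {x\<in>F. \<pi> x = g}" for g
  define A where "A = {g\<in>G. \<exists>x\<in>fib g. \<exists>y\<in>fib g. x \<noteq> y}"
  have \<pi>: "\<pi> x i = x i" if "i \<in> I" for x i using that insert.hyps unfolding \<pi>_def by auto
  have count: "card {i\<in>insert k I. P i} = card {i\<in>I. P i} + (if P k then 1 else 0)" for P
  proof -
    have "{i\<in>insert k I. P i} = (if P k then insert k {i\<in>I. P i} else {i\<in>I. P i})" by auto
    then show ?thesis using insert.hyps by auto
  qed
  have d2: "card {i\<in>insert k I. x i - y i = 1} \<le> 2" if "x \<in> F" "y \<in> F" "x \<noteq> y" for x y
    using insert.prems(2) that unfolding spread_le_def by blast
  have d3: "card {i\<in>insert k I. x i + y i + z i = e} \<le> 3"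
    if "x \<in> F" "y \<in> F" "z \<in> F" "x \<noteq> y" "x \<noteq> z" "y \<noteq> z" "e \<in> {1,-1}" for x y z e
    using insert.prems(2) that unfolding spread_le_def by blast
  have p2: "card {i\<in>I. \<pi> x i - \<pi> y i = 1} = card {i\<in>I. x i - y i = 1}" for x y
    by (rule arg_cong[where f = card]) (auto simp: \<pi>)
  have p3: "card {i\<in>I. \<pi> x i + \<pi> y i + \<pi> z i = e} = card {i\<in>I. x i + y i + z i = e}" for x y z e
    by (rule arg_cong[where f = card]) (auto simp: \<pi>)
  have spG: "spread_le I 2 3 G"
    unfolding spread_le_def
  proof (intro conjI ballI impI)
    fix g h assume "g \<in> G" "h \<in> G" "g \<noteq> h"
    then obtain x y where "x \<in> F" "y \<in> F" "g = \<pi> x" "h = \<pi> y" "x \<noteq> y" unfolding G_def by blast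
    then show "card {i\<in>I. g i - h i = 1} \<le> 2" using d2[of x y] unfolding count by (simp add: p2)
  next
    fix g h l e assume "g \<in> G" "h \<in> G" "l \<in> G" "g \<noteq> h \<and> g \<noteq> l \<and> h \<noteq> l" and e: "e \<in> {1,-1::3}"
    then obtain x y z where "x \<in> F" "y \<in> F" "z \<in> F" "g = \<pi> x" "h = \<pi> y" "l = \<pi> z"
      "x \<noteq> y" "x \<noteq> z" "y \<noteq> z" unfolding G_def by blast
    then show "card {i\<in>I. g i + h i + l i = e} \<le> 3"
      using d3[of x y z e] e unfolding count by (simp add: p3)
  qed
  have fibk: "x = y" if "x \<in> fib g" "y \<in> fib g" "x k = y k" for x y g
  proof
    fix i show "x i = y i"
      using that unfolding fib_def \<pi>_def by (metis (mono_tags, lifting) fun_upd_triv fun_upd_upd mem_Collect_eq)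
  qed
  text \<open>A fibre with two points takes two values at the coordinate \<open>k\<close>, and sums or differences of two
    such value sets cover GF(3); so one of the entries allowed by the bounds is used up at \<open>k\<close>.\<close>
  have spA: "spread_le I 1 2 A"
    unfolding spread_le_def
  proof (intro conjI ballI impI)
    fix g h assume gh: "g \<in> A" "h \<in> A" "g \<noteq> h"
    obtain x x' where x: "x \<in> fib g" "x' \<in> fib g" "x k \<noteq> x' k"
      using gh(1) fibk unfolding A_def by blast
    obtain y y' where y: "y \<in> fib h" "y' \<in> fib h" "y k \<noteq> y' k"
      using gh(2) fibk unfolding A_def by blast
    obtain u v where uv: "u \<in> fib g" "v \<in> fib h" "u k - v k = 1"
      using gf3_diff_cover[OF x(3) y(3), of 1] x y by blast
    then have "u \<in> F" "v \<in> F" "\<pi> u = g" "\<pi> v = h" unfolding fib_def by auto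
    then show "card {i\<in>I. g i - h i = 1} \<le> 1"
      using d2[of u v] gh(3) p2[of u v] uv(3) unfolding count by auto
  next
    fix g h l e assume gh: "g \<in> A" "h \<in> A" "l \<in> A" "g \<noteq> h \<and> g \<noteq> l \<and> h \<noteq> l" and e: "e \<in> {1,-1::3}"
    obtain x x' where x: "x \<in> fib g" "x' \<in> fib g" "x k \<noteq> x' k"
      using gh(1) fibk unfolding A_def by blast
    obtain y y' where y: "y \<in> fib h" "y' \<in> fib h" "y k \<noteq> y' k"
      using gh(2) fibk unfolding A_def by blast
    \<comment> \<open>Any point of the third fibre will do: the pairs from the first two already
      reach every value of the sum at \<open>k\<close>.\<close>
    obtain w where w: "w \<in> fib l" using gh(3) unfolding A_def by blast
    obtain u v where uv: "u \<in> fib g" "v \<in> fib h" "u k + v k + w k = e"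
      using gf3_sum_cover[OF x(3) y(3), of "w k" e] x y by blast
    have "u \<in> F" "v \<in> F" "w \<in> F" "\<pi> u = g" "\<pi> v = h" "\<pi> w = l" using uv w unfolding fib_def by auto
    then show "card {i\<in>I. g i + h i + l i = e} \<le> 2"
      using d3[of u v w e] e gh(4) p3[of u v w e] uv(3) unfolding count by auto
  qed
  have suppG: "g i = 0" if "g \<in> G" "i \<notin> I" for g i
    using that insert.prems(3) unfolding G_def \<pi>_def by auto
  have "card A \<le> 7"
    by (rule spread_le_1_2_card_le[OF insert.hyps(1) spA]) (use suppG A_def in auto)
  have finG: "finite G" using insert.prems(1) unfolding G_def by simp
  have cG: "card G \<le> 14 * card I + 1" by (rule insert.IH[OF finG spG]) (rule suppG)
  have finfib: "finite (fib g)" for g using insert.prems(1) unfolding fib_def by simp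
  have fib3: "card (fib g) \<le> 1 + (if g \<in> A then 2 else 0)" if "g \<in> G" for g
  proof (cases "g \<in> A")
    case True
    have "card (fib g) = card ((\<lambda>x. x k) ` fib g)"
      by (rule card_image[symmetric]) (auto intro!: inj_onI fibk)
    also have "\<dots> \<le> card (UNIV :: 3 set)" by (rule card_mono) auto
    finally show ?thesis using True by simp
  next
    case False
    then show ?thesis using that finfib unfolding A_def by (auto simp: card_le_Suc0_iff_eq)
  qed
  have "F = (\<Union>g\<in>G. fib g)" unfolding G_def fib_def by auto
  then have "card F \<le> (\<Sum>g\<in>G. card (fib g))" using card_UN_le[OF finG, of fib] by simp
  also have "\<dots> \<le> (\<Sum>g\<in>G. 1 + (if g \<in> A then 2 else 0))" by (rule sum_mono) (rule fib3)
  also have "\<dots> = card G + 2 * card (G \<inter> A)"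
    using finG by (simp add: sum.distrib sum.If_cases del: One_nat_def)
  also have "G \<inter> A = A" unfolding A_def by auto
  finally show ?case using cG \<open>card A \<le> 7\<close> insert.hyps by simp
qed

section \<open>Linear algebra over GF(3)\<close>

text \<open>The counterpart of \<open>gf3_indep\<close> over the type \<open>3\<close>, so that ring
  laws replace congruences of integers.\<close>

definition indep3 :: "('a \<Rightarrow> nat \<Rightarrow> 3) \<Rightarrow> 'a set \<Rightarrow> bool" where
  "indep3 w X \<longleftrightarrow> (\<forall>c. (\<forall>i. (\<Sum>x\<in>X. c x * w x i) = 0) \<longrightarrow> (\<forall>x\<in>X. c x = 0))"

definition spans3 :: "('a \<Rightarrow> nat \<Rightarrow> 3) \<Rightarrow> 'a set \<Rightarrow> 'a \<Rightarrow> bool" where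
  "spans3 w S t \<longleftrightarrow> (\<exists>c. \<forall>i. w t i = (\<Sum>b\<in>S. c b * w b i))"

lemma indep3D: "indep3 w X \<Longrightarrow> (\<And>i. (\<Sum>x\<in>X. c x * w x i) = 0) \<Longrightarrow> x \<in> X \<Longrightarrow> c x = 0"
  unfolding indep3_def by blast

lemma spans3I: "(\<And>i. w t i = (\<Sum>b\<in>S. c b * w b i)) \<Longrightarrow> spans3 w S t"
  unfolding spans3_def by blast

lemma gf3_indep_iff_indep3: "gf3_indep v X \<longleftrightarrow> indep3 (\<lambda>x i. of_int (v x i)) X"
proof
  assume L: "gf3_indep v X"
  show "indep3 (\<lambda>x i. of_int (v x i)) X"
    unfolding indep3_def
  proof (intro allI impI)
    fix c :: "'a \<Rightarrow> 3"
    assume c: "\<forall>i. (\<Sum>x\<in>X. c x * of_int (v x i)) = 0"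
    have "\<exists>k. of_int k = z" for z :: 3
      using gf3_cases[of z] exI[of "\<lambda>k. of_int k = z" 0] exI[of "\<lambda>k. of_int k = z" 1]
        exI[of "\<lambda>k. of_int k = z" "-1"] by auto
    then have "\<forall>x. \<exists>k. of_int k = c x" by simp
    then obtain d where d: "\<And>x. of_int (d x) = c x" by metis
    have "(\<Sum>x\<in>X. d x * v x i) mod 3 = 0" for i
      using c by (simp add: of_int_gf3_eq_0_iff[symmetric] d)
    then have "\<forall>x\<in>X. d x mod 3 = 0" using L unfolding gf3_indep_def by blast
    then show "\<forall>x\<in>X. c x = 0" by (simp add: of_int_gf3_eq_0_iff[symmetric] d)
  qed
next
  assume R: "indep3 (\<lambda>x i. of_int (v x i)) X"
  show "gf3_indep v X"
    unfolding gf3_indep_def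
  proof (intro allI impI)
    fix c :: "'a \<Rightarrow> int"
    assume "\<forall>i. (\<Sum>x\<in>X. c x * v x i) mod 3 = 0"
    then have "\<forall>i. (\<Sum>x\<in>X. of_int (c x) * of_int (v x i)) = (0::3)"
      by (simp add: of_int_gf3_eq_0_iff[symmetric])
    then have "of_int (c x) = (0::3)" if "x \<in> X" for x
      using indep3D[OF R, of "\<lambda>x. of_int (c x)"] that by blast
    then show "\<forall>x\<in>X. c x mod 3 = 0" by (simp add: of_int_gf3_eq_0_iff)
  qed
qed

text \<open>Independence of \<open>S\<close> forces a nonzero coefficient at \<open>x\<close> in the
  dependence, and one can solve for \<open>x\<close>.\<close>

lemma spans3_if_dependent_insert:
  assumes "finite S" "x \<notin> S" "indep3 w S" "\<not> indep3 w (insert x S)"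
  shows "spans3 w S x"
proof -
  obtain c y where c: "\<And>i. (\<Sum>y\<in>insert x S. c y * w y i) = 0" and y: "y \<in> insert x S" "c y \<noteq> 0"
    using assms(4) unfolding indep3_def by blast
  have eq: "c x * w x i + (\<Sum>y\<in>S. c y * w y i) = 0" for i using c[of i] assms(1,2) by simp
  have "c x \<noteq> 0"
  proof
    assume 0: "c x = 0"
    then have "\<forall>y\<in>S. c y = 0" using eq assms(3) unfolding indep3_def by simp
    then show False using y 0 by auto
  qed
  then have sq: "c x * c x = 1" by (rule gf3_square)
  have "w x i = (\<Sum>y\<in>S. - c x * c y * w y i)" for i
  proof -
    have "w x i = c x * (c x * w x i)" using sq by (simp add: mult.assoc[symmetric])
    also have "c x * w x i = - (\<Sum>y\<in>S. c y * w y i)" using eq[of i] by (simp add: eq_neg_iff_add_eq_0)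
    finally show ?thesis by (simp add: sum_distrib_left sum_negf mult.assoc)
  qed
  then show ?thesis by (rule spans3I)
qed

lemma dependent_insert_if_spans3:
  assumes "finite S" "x \<notin> S" "spans3 w S x"
  shows "\<not> indep3 w (insert x S)"
proof
  assume ind: "indep3 w (insert x S)"
  obtain c where c: "\<And>i. w x i = (\<Sum>b\<in>S. c b * w b i)" using assms(3) unfolding spans3_def by blast
  let ?d = "\<lambda>y. if y = x then -1 else c y"
  have "(\<Sum>y\<in>insert x S. ?d y * w y i) = 0" for i
  proof -
    have "(\<Sum>y\<in>S. ?d y * w y i) = (\<Sum>y\<in>S. c y * w y i)"
      by (rule sum.cong) (use assms(2) in auto)
    then show ?thesis using assms(1,2) c[of i] by simp
  qed
  then have "?d x = 0" by (rule indep3D[OF ind]) simp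
  then show False by simp
qed

lemma indep3_subset:
  assumes "finite Y" "X \<subseteq> Y" "indep3 w Y"
  shows "indep3 w X"
  unfolding indep3_def
proof (intro allI impI)
  fix c assume c: "\<forall>i. (\<Sum>x\<in>X. c x * w x i) = 0"
  let ?d = "\<lambda>x. if x \<in> X then c x else 0"
  have "(\<Sum>x\<in>Y. ?d x * w x i) = (\<Sum>x\<in>X. c x * w x i)" for i
    using assms(1,2) by (intro sum.mono_neutral_cong_right) auto
  then have "?d x = 0" if "x \<in> Y" for x using c that indep3D[OF assms(3), of ?d] by simp
  then show "\<forall>x\<in>X. c x = 0" using assms(2) by (metis subsetD)
qed

text \<open>Turns a vanishing coefficient into a smaller spanning set, which is how minimality gets
  contradicted.\<close>

lemma spans3_nonzero_support:
  assumes "finite S" "\<And>i. w t i = (\<Sum>b\<in>S. c b * w b i)"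
  shows "spans3 w {b\<in>S. c b \<noteq> 0} t"
proof -
  have "(\<Sum>b\<in>S. c b * w b i) = (\<Sum>b\<in>{b\<in>S. c b \<noteq> 0}. c b * w b i)" for i
    using assms(1) by (intro sum.mono_neutral_right) auto
  then show ?thesis using assms(2) unfolding spans3_def by auto
qed

lemma indep3_if_minimal_span:
  assumes "finite T" "spans3 w T t" and min: "\<And>S. S \<subset> T \<Longrightarrow> \<not> spans3 w S t"
  shows "indep3 w T"
  unfolding indep3_def
proof (intro allI impI, rule ccontr)
  fix c assume c: "\<forall>i. (\<Sum>x\<in>T. c x * w x i) = 0" and "\<not> (\<forall>x\<in>T. c x = 0)"
  then obtain y where y: "y \<in> T" "c y \<noteq> 0" by blast
  obtain a where a: "\<And>i. w t i = (\<Sum>b\<in>T. a b * w b i)" using assms(2) unfolding spans3_def by blast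
  \<comment> \<open>Subtracting this multiple of the dependence cancels the coefficient at
    \<open>y\<close>, because \<open>c y\<close> is its own inverse.\<close>
  let ?d = "\<lambda>b. a b - a y * c y * c b"
  have "w t i = (\<Sum>b\<in>T. ?d b * w b i)" for i
  proof -
    have "(\<Sum>b\<in>T. ?d b * w b i) = (\<Sum>b\<in>T. a b * w b i) - a y * c y * (\<Sum>b\<in>T. c b * w b i)"
      by (simp add: sum_distrib_left sum_subtractf left_diff_distrib mult.assoc)
    then show ?thesis using a c by simp
  qed
  then have "spans3 w {b\<in>T. ?d b \<noteq> 0} t" by (rule spans3_nonzero_support[OF assms(1)])
  moreover have "?d y = 0" using gf3_square[OF y(2)] by (simp add: mult.assoc)
  ultimately show False using min[of "{b\<in>T. ?d b \<noteq> 0}"] y(1) by blast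
qed

text \<open>Coordinates with respect to a basis \<open>B\<close> scaled by the signs \<open>\<alpha>\<close>, so that the loose element
  \<open>t\<close> becomes the indicator vector of \<open>T\<close>.\<close>
locale loose_coordinates =
  fixes E T B :: "'a set" and t :: 'a and w :: "'a \<Rightarrow> nat \<Rightarrow> 3"
    and \<alpha> :: "'a \<Rightarrow> 3" and \<kappa> :: "'a \<Rightarrow> 'a \<Rightarrow> 3"
  assumes finite_E: "finite E" and t_in: "t \<in> E"
    and T_sub: "T \<subseteq> B" and B_sub: "B \<subseteq> E - {t}" and T_ne: "T \<noteq> {}"
    and t_eq: "w t i = (\<Sum>b\<in>T. \<alpha> b * w b i)"
    and coord: "x \<in> E - {t} \<Longrightarrow> w x i = (\<Sum>b\<in>B. \<kappa> x b * \<alpha> b * w b i)"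
    and minimal: "S \<subseteq> E - {t} \<Longrightarrow> spans3 w S t \<Longrightarrow> card T \<le> card S"
    and non_parallel: "x \<in> E - {t} \<Longrightarrow> y \<in> E - {t} \<Longrightarrow> x \<noteq> y \<Longrightarrow> \<not> (\<forall>i. w x i = e * w y i)"
begin

section \<open>Consequences of the minimality of \<open>T\<close>\<close>

lemma finite_B: "finite B" and finite_T: "finite T"
  using finite_E T_sub B_sub by (meson finite_Diff finite_subset)+

text \<open>Since \<open>t\<close> is all ones on \<open>T\<close>, a combination of
  \<open>X\<close> supported on \<open>T\<close> needs correcting only at the set \<open>D\<close>
  of entries different from 1. So \<open>X \<union> D\<close> spans \<open>t\<close>, and minimality
  gives \<open>card T \<le> card X + card D\<close>.\<close>

lemma ones_le:
  assumes X: "X \<subseteq> E - {t} - T"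
    and zero: "\<And>b. b \<in> B - T \<Longrightarrow> (\<Sum>x\<in>X. m x * \<kappa> x b) = 0"
  shows "card {b\<in>T. (\<Sum>x\<in>X. m x * \<kappa> x b) = 1} \<le> card X"
proof -
  define u where "u b = (\<Sum>x\<in>X. m x * \<kappa> x b)" for b
  define D where "D = {b\<in>T. u b \<noteq> 1}"
  \<comment> \<open>On \<open>D\<close> the entry \<open>u y\<close> is raised to 1; the factor
    \<open>\<alpha> y\<close> undoes the scaling of the coordinates.\<close>
  define c where "c y = (if y \<in> X then m y else (1 - u y) * \<alpha> y)" for y
  have finX: "finite X" using X finite_E finite_subset by blast
  have "w t i = (\<Sum>y\<in>X \<union> D. c y * w y i)" for i
  proof -
    have "(\<Sum>x\<in>X. m x * w x i) = (\<Sum>x\<in>X. \<Sum>b\<in>B. m x * \<kappa> x b * \<alpha> b * w b i)"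
    proof (rule sum.cong)
      fix x assume "x \<in> X"
      then have "x \<in> E - {t}" using X by auto
      then show "m x * w x i = (\<Sum>b\<in>B. m x * \<kappa> x b * \<alpha> b * w b i)"
        using coord[of x i] by (simp add: sum_distrib_left mult.assoc)
    qed simp
    also have "\<dots> = (\<Sum>b\<in>B. u b * \<alpha> b * w b i)"
      by (subst sum.swap) (simp add: u_def sum_distrib_right)
    also have "\<dots> = (\<Sum>b\<in>T. u b * \<alpha> b * w b i)"
      using finite_B T_sub zero by (intro sum.mono_neutral_right) (auto simp: u_def)
    finally have 1: "(\<Sum>x\<in>X. m x * w x i) = (\<Sum>b\<in>T. u b * \<alpha> b * w b i)" .
    have "(\<Sum>y\<in>X \<union> D. c y * w y i) = (\<Sum>y\<in>X. c y * w y i) + (\<Sum>y\<in>D. c y * w y i)"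
      using finX finite_T X unfolding D_def by (intro sum.union_disjoint) auto
    also have "(\<Sum>y\<in>X. c y * w y i) = (\<Sum>x\<in>X. m x * w x i)"
      by (simp add: c_def)
    also have "(\<Sum>y\<in>D. c y * w y i) = (\<Sum>y\<in>T. (1 - u y) * \<alpha> y * w y i)"
      using finite_T X unfolding D_def c_def by (intro sum.mono_neutral_cong_left) auto
    also have "\<dots> = w t i - (\<Sum>b\<in>T. u b * \<alpha> b * w b i)"
      by (simp add: t_eq sum_subtractf left_diff_distrib)
    finally show ?thesis using 1 by simp
  qed
  then have "spans3 w (X \<union> D) t" by (rule spans3I)
  moreover have "X \<union> D \<subseteq> E - {t}" using X T_sub B_sub unfolding D_def by auto
  ultimately have "card T \<le> card (X \<union> D)" by (rule minimal[rotated])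
  also have "\<dots> \<le> card X + card D" by (rule card_Un_le)
  finally have "card T \<le> card X + card D" .
  moreover have "card T = card {b\<in>T. u b = 1} + card D"
  proof -
    have "T = {b\<in>T. u b = 1} \<union> D" unfolding D_def by auto
    moreover have "card ({b\<in>T. u b = 1} \<union> D) = card {b\<in>T. u b = 1} + card D"
      using finite_T unfolding D_def by (intro card_Un_disjoint) auto
    ultimately show ?thesis by simp
  qed
  ultimately show ?thesis unfolding u_def by simp
qed

text \<open>These elements lie in the span of \<open>T\<close>. If \<open>B - T = {q}\<close>, those
  of \<open>outer\<close> have a nonzero entry at \<open>q\<close>.\<close>

definition "inner = {x \<in> E - {t} - T. \<forall>b\<in>B - T. \<kappa> x b = 0}"
definition "outer = E - {t} - T - inner"

lemma coord_inner:
  assumes "x \<in> inner"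
  shows "w x i = (\<Sum>b\<in>T. \<kappa> x b * \<alpha> b * w b i)"
proof -
  have "w x i = (\<Sum>b\<in>B. \<kappa> x b * \<alpha> b * w b i)" using assms coord unfolding inner_def by auto
  also have "\<dots> = (\<Sum>b\<in>T. \<kappa> x b * \<alpha> b * w b i)"
    using assms finite_B T_sub unfolding inner_def by (intro sum.mono_neutral_right) auto
  finally show ?thesis .
qed

text \<open>Otherwise \<open>x\<close> would be a multiple of the single element \<open>b\<close> of
  \<open>T\<close>.\<close>

lemma inner_two_nonzero:
  assumes "x \<in> inner" "b \<in> T"
  shows "\<exists>b'\<in>T - {b}. \<kappa> x b' \<noteq> 0"
proof (rule ccontr)
  assume "\<not> ?thesis"
  then have "(\<Sum>b'\<in>T. \<kappa> x b' * \<alpha> b' * w b' i) = \<kappa> x b * \<alpha> b * w b i" for i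
    using assms(2) finite_T by (subst sum.remove[of _ b]) (auto intro!: sum.neutral)
  then have "\<forall>i. w x i = (\<kappa> x b * \<alpha> b) * w b i" using coord_inner[OF assms(1)] by simp
  then show False
    using non_parallel[of x b "\<kappa> x b * \<alpha> b"] assms T_sub B_sub unfolding inner_def by auto
qed

text \<open>\<open>ones_le\<close> for \<open>x\<close> and for its negative allows at most one
  entry of each sign, and two entries are nonzero.\<close>

lemma inner_arc:
  assumes x: "x \<in> inner"
  obtains p n where "{b\<in>T. \<kappa> x b = 1} = {p}" "{b\<in>T. \<kappa> x b = -1} = {n}"
proof -
  have le: "card {b\<in>T. e * \<kappa> x b = 1} \<le> 1" for e
    using ones_le[of "{x}" "\<lambda>_. e"] x by (simp add: inner_def)
  have sgl: "\<exists>p. {b\<in>T. \<kappa> x b = e} = {p}" if e: "e \<in> {1,-1}" for e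
  proof -
    have uniq: "b = b'" if "b \<in> T" "b' \<in> T" "\<kappa> x b = d" "\<kappa> x b' = d" "d \<in> {1,-1}" for b b' d
    proof -
      have "card {b\<in>T. d * \<kappa> x b = 1} \<le> Suc 0" using le by simp
      moreover have "finite {b\<in>T. d * \<kappa> x b = 1}" using finite_T by simp
      ultimately show ?thesis using that by (auto simp: card_le_Suc0_iff_eq)
    qed
    have "{b\<in>T. \<kappa> x b = e} \<noteq> {}"
    proof
      assume 0: "{b\<in>T. \<kappa> x b = e} = {}"
      \<comment> \<open>\<open>b\<close> is the position of the entry \<open>-e\<close> if there is
        one, and arbitrary otherwise; a second nonzero entry \<open>b'\<close> then contradicts
        uniqueness.\<close>
      obtain b where b: "b \<in> T" "\<kappa> x b = - e \<or> {b\<in>T. \<kappa> x b = - e} = {}" using T_ne by blast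
      obtain b' where "b' \<in> T - {b}" "\<kappa> x b' \<noteq> 0" using inner_two_nonzero[OF x b(1)] by blast
      then have b': "b' \<in> T" "b' \<noteq> b" "\<kappa> x b' = - e" using 0 e gf3_cases[of "\<kappa> x b'"] by auto
      then show False using uniq[of b b' "-e"] b e by auto
    qed
    then show ?thesis using uniq e by blast
  qed
  show thesis using that sgl[of 1] sgl[of "-1"] by auto
qed

text \<open>Sending each arc to its position \<open>p\<close> of entry 1 is injective. Two arcs that
  agree there and at \<open>n\<close> are parallel; if they agree only at \<open>p\<close>, the
  negated sum has three entries 1, one more than \<open>ones_le\<close> permits.\<close>

lemma card_inner_le: "card inner \<le> card T"
proof -
  define p where "p x = the_elem {b\<in>T. \<kappa> x b = 1}" for x
  define n where "n x = the_elem {b\<in>T. \<kappa> x b = -1}" for x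
  have p: "{b\<in>T. \<kappa> x b = 1} = {p x}" and n: "{b\<in>T. \<kappa> x b = -1} = {n x}" if "x \<in> inner" for x
    by (rule inner_arc[OF that], simp add: p_def n_def)+
  have "inj_on p inner"
  proof (rule inj_onI, rule ccontr)
    fix x y assume xy: "x \<in> inner" "y \<in> inner" "p x = p y" "x \<noteq> y"
    have px: "p x \<in> T" "\<kappa> x (p x) = 1" "\<kappa> y (p x) = 1" using p[OF xy(1)] p[OF xy(2)] xy(3) by auto
    have nx: "n x \<in> T" "\<kappa> x (n x) = -1" "n y \<in> T" "\<kappa> y (n y) = -1"
      using n[OF xy(1)] n[OF xy(2)] by auto
    have zx: "\<kappa> x b = 0" if "b \<in> T" "b \<noteq> p x" "b \<noteq> n x" for b
      using gf3_cases[of "\<kappa> x b"] p[OF xy(1)] n[OF xy(1)] that by auto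
    have zy: "\<kappa> y b = 0" if "b \<in> T" "b \<noteq> p x" "b \<noteq> n y" for b
      using gf3_cases[of "\<kappa> y b"] p[OF xy(2)] n[OF xy(2)] that xy(3) by auto
    have ne: "p x \<noteq> n x" "p x \<noteq> n y" using px nx by force+
    show False
    proof (cases "n x = n y")
      case True
      have "\<kappa> x b = \<kappa> y b" if "b \<in> T" for b
        using zx[OF that] zy[OF that] True px nx by (cases "b = p x"; cases "b = n x") auto
      then have "\<forall>i. w x i = 1 * w y i" using coord_inner[OF xy(1)] coord_inner[OF xy(2)] by simp
      then show False using non_parallel[of x y 1] xy unfolding inner_def by auto
    next
      case False
      have "card {b\<in>T. (\<Sum>z\<in>{x,y}. (\<lambda>_. -1) z * \<kappa> z b) = 1} \<le> card {x,y}"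
        by (rule ones_le) (use xy in \<open>auto simp: inner_def\<close>)
      moreover have "{p x, n x, n y} \<subseteq> {b\<in>T. (\<Sum>z\<in>{x,y}. (\<lambda>_. -1) z * \<kappa> z b) = 1}"
        using px nx zx[of "n y"] zy[of "n x"] ne False xy(4) by auto
      then have "card {p x, n x, n y} \<le> card {b\<in>T. (\<Sum>z\<in>{x,y}. (\<lambda>_. -1) z * \<kappa> z b) = 1}"
        using finite_T by (intro card_mono) auto
      ultimately have "card {p x, n x, n y} \<le> card {x,y}" by linarith
      then show False using ne False xy(4) by simp
    qed
  qed
  moreover have "p ` inner \<subseteq> T" using p by auto
  ultimately show ?thesis using finite_T by (rule card_inj_on_le)
qed

lemma card_outer_le:
  assumes q: "B - T = {q}"
  shows "card outer \<le> 14 * card T + 1"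
proof -
  have kq: "\<kappa> x q \<noteq> 0" if "x \<in> outer" for x using that q unfolding outer_def inner_def by auto
  have sq: "\<kappa> x q * \<kappa> x q = 1" if "x \<in> outer" for x using gf3_square[OF kq[OF that]] .
  have HE: "outer \<subseteq> E - {t} - T" unfolding outer_def by auto
  have finH: "finite outer" using HE finite_E finite_subset by blast
  \<comment> \<open>Multiplying by \<open>\<kappa> x q\<close> scales the entry at \<open>q\<close>
    to 1. The value 0 off \<open>T\<close> meets the support condition of the counting
    lemma.\<close>
  define \<phi> where "\<phi> x b = (if b \<in> T then \<kappa> x q * \<kappa> x b else 0)" for x b
  have inj: "inj_on \<phi> outer"
  proof (rule inj_onI, rule ccontr)
    fix x y assume xy: "x \<in> outer" "y \<in> outer" "\<phi> x = \<phi> y" "x \<noteq> y"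
    have k: "\<kappa> x b = \<kappa> x q * \<kappa> y q * \<kappa> y b" if "b \<in> B" for b
    proof (cases "b \<in> T")
      case True
      then have "\<kappa> x q * \<kappa> x b = \<kappa> y q * \<kappa> y b" using fun_cong[OF xy(3), of b] unfolding \<phi>_def by simp
      then have "\<kappa> x q * (\<kappa> x q * \<kappa> x b) = \<kappa> x q * (\<kappa> y q * \<kappa> y b)" by simp
      then show ?thesis using sq[OF xy(1)] by (simp add: mult.assoc[symmetric])
    next
      case False
      then have "b = q" using that q by auto
      then show ?thesis using sq[OF xy(2)] by (simp add: mult.assoc)
    qed
    have "w x i = (\<kappa> x q * \<kappa> y q) * w y i" for i
    proof -
      have "w x i = (\<Sum>b\<in>B. \<kappa> x b * \<alpha> b * w b i)" using coord xy(1) HE by auto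
      also have "\<dots> = (\<Sum>b\<in>B. (\<kappa> x q * \<kappa> y q) * (\<kappa> y b * \<alpha> b * w b i))"
        by (rule sum.cong) (auto simp: k mult.assoc)
      also have "\<dots> = (\<kappa> x q * \<kappa> y q) * w y i"
        using coord[of y i] subsetD[OF HE xy(2)] by (simp add: sum_distrib_left)
      finally show ?thesis .
    qed
    then show False using non_parallel[of x y "\<kappa> x q * \<kappa> y q"] xy HE by auto
  qed
  have "spread_le T 2 3 (\<phi> ` outer)"
    unfolding spread_le_def
  proof (intro conjI ballI impI)
    fix f g assume fg: "f \<in> \<phi> ` outer" "g \<in> \<phi> ` outer" "f \<noteq> g"
    then obtain x y where xy: "x \<in> outer" "y \<in> outer" "f = \<phi> x" "g = \<phi> y" "x \<noteq> y" by blast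
    define m where "m z = (if z = x then \<kappa> x q else - \<kappa> y q)" for z
    have s: "(\<Sum>z\<in>{x,y}. m z * \<kappa> z b) = \<kappa> x q * \<kappa> x b - \<kappa> y q * \<kappa> y b" for b
      using xy(5) by (simp add: m_def)
    have "card {b\<in>T. (\<Sum>z\<in>{x,y}. m z * \<kappa> z b) = 1} \<le> card {x,y}"
      by (rule ones_le) (use xy HE q s sq in auto)
    moreover have "{b\<in>T. (\<Sum>z\<in>{x,y}. m z * \<kappa> z b) = 1} = {b\<in>T. f b - g b = 1}"
      unfolding s xy \<phi>_def by auto
    ultimately show "card {b\<in>T. f b - g b = 1} \<le> 2" using xy(5) by simp
  next
    fix f g h e assume fg: "f \<in> \<phi> ` outer" "g \<in> \<phi> ` outer" "h \<in> \<phi> ` outer" "f \<noteq> g \<and> f \<noteq> h \<and> g \<noteq> h"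
      and e: "e \<in> {1,-1::3}"
    then obtain x y z where xy: "x \<in> outer" "y \<in> outer" "z \<in> outer" "f = \<phi> x" "g = \<phi> y" "h = \<phi> z"
      "x \<noteq> y" "x \<noteq> z" "y \<noteq> z" by blast
    \<comment> \<open>The factor \<open>e\<close> turns entries \<open>e\<close> of the sum into 1;
      at \<open>q\<close> the sum is \<open>e * (1 + 1 + 1) = 0\<close>.\<close>
    define m where "m u = e * \<kappa> u q" for u
    have s: "(\<Sum>u\<in>{x,y,z}. m u * \<kappa> u b) = e * (\<kappa> x q * \<kappa> x b + \<kappa> y q * \<kappa> y b + \<kappa> z q * \<kappa> z b)" for b
      using xy(7-9) by (simp add: m_def algebra_simps)
    have "(\<Sum>u\<in>{x,y,z}. m u * \<kappa> u b) = 0" if "b \<in> B - T" for b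
      unfolding s using that q sq xy(1-3) by simp
    then have "card {b\<in>T. (\<Sum>u\<in>{x,y,z}. m u * \<kappa> u b) = 1} \<le> card {x,y,z}"
      by (intro ones_le) (use xy HE in auto)
    moreover have "{b\<in>T. (\<Sum>u\<in>{x,y,z}. m u * \<kappa> u b) = 1} = {b\<in>T. f b + g b + h b = e}"
    proof -
      have "e * a = 1 \<longleftrightarrow> a = e" for a using e gf3_cases[of a] by auto
      then show ?thesis unfolding s xy \<phi>_def by auto
    qed
    ultimately show "card {b\<in>T. f b + g b + h b = e} \<le> 3" using xy(7-9) by simp
  qed
  then have "card (\<phi> ` outer) \<le> 14 * card T + 1"
    using finite_T finH by (intro spread_le_2_3_card_le) (auto simp: \<phi>_def)
  then show ?thesis using card_image[OF inj] by simp
qed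

lemma card_E_eq: "card E = 1 + card T + card inner + card outer"
proof -
  have "E = insert t (T \<union> (inner \<union> outer))" "t \<notin> T \<union> (inner \<union> outer)" "T \<inter> (inner \<union> outer) = {}" "inner \<inter> outer = {}"
    using t_in T_sub B_sub unfolding inner_def outer_def by auto
  moreover have "finite inner" "finite outer" using finite_E unfolding inner_def outer_def by auto
  ultimately show ?thesis
    using finite_T card_insert_disjoint[of "T \<union> (inner \<union> outer)" t] card_Un_disjoint[of T "inner \<union> outer"]
      card_Un_disjoint[of inner outer] by simp
qed

end

section \<open>Matroids\<close>

lemma matroid_augment:
  assumes "matroid E indep" "indep X" "indep Y" "card X < card Y"
  obtains y where "y \<in> Y - X" "indep (insert y X)"
proof -
  have "\<forall>X Y. indep X \<and> indep Y \<and> card X < card Y \<longrightarrow> (\<exists>y \<in> Y - X. indep (insert y X))"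
    using assms(1) unfolding matroid_def by simp
  then show thesis using assms(2-4) that by blast
qed

lemma basis_card_eq_mrank:
  assumes M: "matroid E indep" and B: "basis E indep B"
  shows "card B = mrank E indep"
proof -
  let ?C = "{card X | X. X \<subseteq> E \<and> indep X}"
  have fE: "finite E" and e: "indep {}" using M unfolding matroid_def by auto
  have "?C \<subseteq> card ` Pow E" by auto
  then have fin: "finite ?C" using fE finite_subset by blast
  have "?C \<noteq> {}" using e by blast
  then have "mrank E indep \<in> ?C" using Max_in[OF fin] unfolding mrank_def by simp
  then obtain X where X: "X \<subseteq> E" "indep X" "card X = mrank E indep" by auto
  have "card B \<in> ?C" using B unfolding basis_def by blast
  then have le: "card B \<le> mrank E indep" using Max_ge[OF fin] unfolding mrank_def by simp
  show ?thesis
  proof (rule ccontr)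
    assume "card B \<noteq> mrank E indep"
    then have "card B < card X" using le X(3) by simp
    then obtain y where y: "y \<in> X - B" "indep (insert y B)"
      using matroid_augment[OF M _ X(2), of B] B unfolding basis_def by blast
    then have "insert y B = B" using B X(1) unfolding basis_def by blast
    then show False using y(1) by blast
  qed
qed

lemma indep_card_le_mrank:
  assumes "matroid E indep" "indep X"
  shows "card X \<le> mrank E indep"
proof -
  have fE: "finite E" and XE: "X \<subseteq> E" using assms unfolding matroid_def by auto
  have "{card X | X. X \<subseteq> E \<and> indep X} \<subseteq> card ` Pow E" by auto
  then have fin: "finite {card X | X. X \<subseteq> E \<and> indep X}" using fE finite_subset by blast
  show ?thesis unfolding mrank_def by (rule Max_ge[OF fin]) (use XE assms(2) in blast)
qed

text \<open>The extension stays inside \<open>T \<union> B\<close>, so it avoids any element missing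
  from both sets.\<close>

lemma indep_extend:
  assumes M: "matroid E indep" and T: "indep T" and B: "indep B"
  obtains B' where "T \<subseteq> B'" "B' \<subseteq> T \<union> B" "indep B'" "card B \<le> card B'"
proof -
  have fE: "finite E" using M unfolding matroid_def by auto
  have sub: "X \<subseteq> E" if "indep X" for X using M that unfolding matroid_def by auto
  let ?S = "{X. T \<subseteq> X \<and> X \<subseteq> T \<union> B \<and> indep X}"
  have "?S \<subseteq> Pow E" using sub by blast
  then have fin: "finite (card ` ?S)" using fE by (meson finite_Pow_iff finite_imageI finite_subset)
  have ne: "card ` ?S \<noteq> {}" using T by auto
  obtain B' where B': "B' \<in> ?S" "card B' = Max (card ` ?S)" using Max_in[OF fin ne] by auto
  have "card B \<le> card B'"
  proof (rule ccontr)
    assume "\<not> card B \<le> card B'"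
    then obtain y where y: "y \<in> B - B'" "indep (insert y B')"
      using matroid_augment[OF M _ B, of B'] B'(1) by auto
    have "insert y B' \<in> ?S" using y B'(1) by auto
    then have "card (insert y B') \<le> card B'" using Max_ge[OF fin] B'(2) by simp
    moreover have "finite B'" using B'(1) finite_subset[OF sub[of B'] fE] by simp
    ultimately show False using y(1) by simp
  qed
  then show thesis using that B'(1) by auto
qed

lemma simple_matroid_pair_indep:
  assumes M: "matroid E indep" and S: "simple_matroid E indep"
    and xy: "x \<in> E" "y \<in> E" "x \<noteq> y"
  shows "indep {x, y}"
proof (rule ccontr)
  assume dep: "\<not> indep {x, y}"
  have e: "indep {}" using M unfolding matroid_def by auto
  have sgl: "indep {z}" if "z \<in> E" for z
  proof (rule ccontr)
    assume "\<not> indep {z}"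
    then have "circuit E indep {z}" using that e unfolding circuit_def by simp
    then show False using S unfolding simple_matroid_def by fastforce
  qed
  have "{x, y} - {x} = {y}" "{x, y} - {y} = {x}" using xy(3) by auto
  then have "circuit E indep {x, y}" using dep sgl xy unfolding circuit_def by simp
  then have "3 \<le> card {x, y}" using S unfolding simple_matroid_def by blast
  then show False using xy(3) by simp
qed

section \<open>Counting the elements of a matroid with a loose element\<close>

text \<open>If \<open>T\<close> is a basis, \<open>outer\<close> is empty and the count is at most
  \<open>1 + r + r\<close>. Otherwise \<open>card T = r - 1\<close>, and \<open>t\<close>,
  \<open>T\<close>, \<open>inner\<close>, \<open>outer\<close> contribute at most 1,
  \<open>r - 1\<close>, \<open>r - 1\<close> and \<open>14 * (r - 1) + 1\<close>.\<close>

lemma card_le_if_loose: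
  fixes w :: "'a \<Rightarrow> nat \<Rightarrow> 3"
  assumes M: "matroid E indep" and S: "simple_matroid E indep"
    and rep: "\<And>X. X \<subseteq> E \<Longrightarrow> indep X \<longleftrightarrow> indep3 w X"
    and r: "mrank E indep = r" "r \<ge> 2"
    and t: "loose E indep t" "\<not> coloop E indep t"
  shows "card E \<le> max (2 * r + 1) (16 * (r - 1) + 2)"
proof -
  have fE: "finite E" using M unfolding matroid_def by auto
  have sub: "X \<subseteq> E" if "indep X" for X using M that unfolding matroid_def by auto
  have tE: "t \<in> E" using t(1) unfolding loose_def by auto
  \<comment> \<open>A basis avoiding \<open>t\<close> exists as \<open>t\<close> is no coloop; it
    shows that \<open>E - {t}\<close> contains a spanning set for \<open>t\<close>.\<close>
  obtain B0 where B0: "basis E indep B0" "t \<notin> B0" using t(2) tE unfolding coloop_def by auto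
  have B0E: "B0 \<subseteq> E" "indep B0" using B0(1) unfolding basis_def by auto
  have "\<not> indep (insert t B0)" using B0 tE B0E unfolding basis_def by blast
  then have "spans3 w B0 t"
    using B0E rep[of B0] rep[of "insert t B0"] tE B0(2) finite_subset[OF _ fE]
    by (intro spans3_if_dependent_insert) auto
  then have "B0 \<subseteq> E - {t} \<and> spans3 w B0 t" using B0E B0(2) by blast
  from ex_has_least_nat[where P = "\<lambda>S. S \<subseteq> E - {t} \<and> spans3 w S t" and m = card, OF this]
  obtain T where T: "T \<subseteq> E - {t}" "spans3 w T t"
    and min: "\<And>S. S \<subseteq> E - {t} \<Longrightarrow> spans3 w S t \<Longrightarrow> card T \<le> card S"
    by auto
  have finT: "finite T" using T(1) fE finite_subset by blast
  have smaller: "\<not> spans3 w S t" if "S \<subset> T" for S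
    using min[of S] psubset_card_mono[OF finT that] that T(1) by auto
  have indT3: "indep3 w T" by (rule indep3_if_minimal_span[OF finT T(2) smaller])
  then have indT: "indep T" using rep T(1) by blast
  \<comment> \<open>Looseness of \<open>t\<close> enters only through this circuit, which forces
    \<open>card T\<close> to be at least \<open>r - 1\<close>.\<close>
  have "circuit E indep (insert t T)"
    unfolding circuit_def
  proof (intro conjI ballI)
    show "insert t T \<subseteq> E" using T(1) tE by auto
    show "\<not> indep (insert t T)"
      using dependent_insert_if_spans3[OF finT _ T(2)] rep[of "insert t T"] T(1) tE by blast
    fix x assume x: "x \<in> insert t T"
    show "indep (insert t T - {x})"
    proof (cases "x = t")
      case True
      then have "insert t T - {x} = T" using T(1) by auto
      then show ?thesis using indT by simp
    next
      case False
      then have eq: "insert t T - {x} = insert t (T - {x})" and "x \<in> T" using x by auto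
      then have "\<not> spans3 w (T - {x}) t" using smaller[of "T - {x}"] by blast
      moreover have "indep3 w (T - {x})" by (rule indep3_subset[OF finT _ indT3]) auto
      ultimately have "indep3 w (insert t (T - {x}))"
        using spans3_if_dependent_insert[of "T - {x}" t w] finT T(1) by blast
      then show ?thesis unfolding eq using rep[of "insert t (T - {x})"] T(1) tE by blast
    qed
  qed
  then have "r \<le> card (insert t T)" using t(1) r(1) unfolding loose_def by blast
  moreover have "card (insert t T) = card T + 1" using T(1) finT by (subst card_insert_disjoint) auto
  ultimately have rT: "r \<le> card T + 1" by simp
  obtain B where B: "T \<subseteq> B" "B \<subseteq> T \<union> B0" "indep B" "card B0 \<le> card B"
    by (rule indep_extend[OF M indT B0E(2)])
  have finB: "finite B" using sub[OF B(3)] fE finite_subset by blast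
  have cB: "card B = r"
    using B(4) basis_card_eq_mrank[OF M B0(1)] indep_card_le_mrank[OF M B(3)] r(1) by simp
  have BE: "B \<subseteq> E - {t}" using B(2) T(1) B0E(1) B0(2) by blast
  have spanB: "spans3 w B x" if "x \<in> E" for x
  proof (cases "x \<in> B")
    case True
    have "w x i = (\<Sum>b\<in>B. (if b = x then 1 else 0) * w b i)" for i
      using True finB by (simp add: if_distrib[of "\<lambda>c. c * _"] sum.delta cong: if_cong)
    then show ?thesis by (rule spans3I)
  next
    case False
    then have "\<not> indep (insert x B)"
      using indep_card_le_mrank[OF M, of "insert x B"] finB cB r(1) by auto
    then show ?thesis
      using False finB B(3) rep[of B] rep[of "insert x B"] sub[OF B(3)] that
      by (intro spans3_if_dependent_insert) auto
  qed
  then have "\<forall>x. \<exists>c. x \<in> E \<longrightarrow> (\<forall>i. w x i = (\<Sum>b\<in>B. c b * w b i))" unfolding spans3_def by blast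
  then obtain c where c: "\<And>x i. x \<in> E \<Longrightarrow> w x i = (\<Sum>b\<in>B. c x b * w b i)"
    unfolding choice_iff by blast
  obtain a where a: "\<And>i. w t i = (\<Sum>b\<in>T. a b * w b i)" using T(2) unfolding spans3_def by blast
  \<comment> \<open>Minimality makes every coefficient of \<open>t\<close> on \<open>T\<close>
    nonzero, so these coefficients can serve as the signs \<open>\<alpha>\<close>.\<close>
  have "{b\<in>T. a b \<noteq> 0} = T"
    using spans3_nonzero_support[OF finT, of w t a] a smaller[of "{b\<in>T. a b \<noteq> 0}"] by blast
  then have a0: "a b \<noteq> 0" if "b \<in> T" for b using that by blast
  define \<alpha> where "\<alpha> b = (if b \<in> T then a b else 1)" for b
  define \<kappa> where "\<kappa> x b = c x b * \<alpha> b" for x b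
  have sq: "\<alpha> b * \<alpha> b = 1" for b using gf3_square[OF a0] unfolding \<alpha>_def by auto
  interpret loose_coordinates E T B t w \<alpha> \<kappa>
  proof
    show "T \<noteq> {}" using rT r(2) by auto
    show "w t i = (\<Sum>b\<in>T. \<alpha> b * w b i)" for i using a by (simp add: \<alpha>_def)
    show "w x i = (\<Sum>b\<in>B. \<kappa> x b * \<alpha> b * w b i)" if "x \<in> E - {t}" for x i
      using c[of x i] that by (simp add: \<kappa>_def mult.assoc[of "c x _"] sq)
    show "\<not> (\<forall>i. w x i = e * w y i)" if xy: "x \<in> E - {t}" "y \<in> E - {t}" "x \<noteq> y" for x y e
    proof
      assume "\<forall>i. w x i = e * w y i"
      then have "spans3 w {y} x" by (intro spans3I[where c = "\<lambda>_. e"]) simp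
      then have "\<not> indep3 w {x, y}" using dependent_insert_if_spans3[of "{y}" x w] xy(3) by simp
      moreover have "indep {x, y}" using simple_matroid_pair_indep[OF M S] xy by blast
      ultimately show False using rep[of "{x, y}"] xy by auto
    qed
  qed (use fE tE B(1) BE min in auto)
  show ?thesis
  proof (cases "B = T")
    case True
    then have "outer = {}" unfolding outer_def inner_def by auto
    then show ?thesis using card_E_eq card_inner_le cB True by simp
  next
    case False
    then have "card T < r" using B(1) cB psubset_card_mono[OF finB, of T] by blast
    then have cT: "card T = r - 1" using rT by simp
    then have "card (B - T) = 1" using B(1) finT cB r(2) by (simp add: card_Diff_subset)
    then obtain q where "B - T = {q}" by (rule card_1_singletonE)
    then show ?thesis using card_E_eq card_inner_le card_outer_le cT by fastforce
  qed
qed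

theorem theorem3p1:
  fixes E :: "'a set" and indep :: "'a set \<Rightarrow> bool" and r :: nat
  assumes "matroid E indep"
    and "simple_matroid E indep"
    and "ternary E indep"
    and "mrank E indep = r"
    and "r \<ge> 5"
    and "\<exists>t. loose E indep t"
    and "\<not> (\<exists>e. coloop E indep e)"
  shows "(r > 10 \<longrightarrow> real (card E) \<le> \<lfloor>(41 * real r - 101) / 2\<rfloor>) \<and>
         (r \<le> 10 \<longrightarrow> real (card E) \<le> \<lfloor>(35 * real r - 35) / 2\<rfloor>)"
proof -
  obtain t where t: "loose E indep t" using assms(6) by blast
  obtain v :: "'a \<Rightarrow> nat \<Rightarrow> int" where v: "\<And>X. X \<subseteq> E \<Longrightarrow> indep X \<longleftrightarrow> gf3_indep v X"
    using assms(3) unfolding ternary_def by blast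
  have "card E \<le> max (2 * r + 1) (16 * (r - 1) + 2)"
  proof (rule card_le_if_loose[OF assms(1,2) _ assms(4) _ t])
    show "indep X \<longleftrightarrow> indep3 (\<lambda>x i. of_int (v x i)) X" if "X \<subseteq> E" for X
      unfolding v[OF that] by (rule gf3_indep_iff_indep3)
    show "2 \<le> r" using assms(5) by simp
    show "\<not> coloop E indep t" using assms(7) by blast
  qed
  \<comment> \<open>For \<open>r \<ge> 5\<close> the second term of the maximum dominates and equals
    \<open>16 * r - 14\<close>. It lies below the two targets because \<open>9 * r \<ge> 73\<close>
    when \<open>r > 10\<close>, and \<open>3 * r \<ge> 7\<close>.\<close>
  then have *: "card E + 14 \<le> 16 * r" using assms(5) by auto
  have floor: "real (card E) \<le> \<lfloor>x\<rfloor>" if "real (card E) \<le> x" for x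
  proof -
    have "int (card E) \<le> \<lfloor>x\<rfloor>" using that by (simp add: le_floor_iff)
    then have "real_of_int (int (card E)) \<le> real_of_int \<lfloor>x\<rfloor>" by (simp only: of_int_le_iff)
    then show ?thesis by simp
  qed
  have "real (card E) \<le> (41 * real r - 101) / 2" if "r > 10" using * that by simp
  moreover have "real (card E) \<le> (35 * real r - 35) / 2" using * assms(5) by simp
  ultimately show ?thesis using floor by blast
qed

end
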